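(* Let $K$ be a field, $\kappa,\lambda\in K$, let $(A,\mu,\alpha,\beta)$ be a BiHom-commutative BiHom-associative algebra and let $\mathfrak D:A\to A$ be a $\lambda$-$(\mathrm{id},\mathrm{id})$-derivation such that any two of the maps $\alpha,\beta,\mathfrak D$ commute. Define $a\ast b=a\mathfrak D(b)+\kappa ab$ for $a,b\in A$. Then $(A,\mu,\ast,\alpha,\beta)$ is a BiHom-Novikov-Poisson algebra.
   Context: BiHom-associative algebra $(A,\mu,\alpha,\beta)$: a $K$-vector space with linear $\mu:A\otimes A\to A$ (written $ab$), $\alpha,\beta:A\to A$ such that $\alpha\beta=\beta\alpha$, $\alpha(ab)=\alpha(a)\alpha(b)$, $\beta(ab)=\beta(a)\beta(b)$, $\alpha(a)(bc)=(ab)\beta(c)$. BiHom-commutative: $\beta(a)\alpha(b)=\beta(b)\alpha(a)$ for all $a,b$. $\lambda$-$(\mathrm{id},\mathrm{id})$-derivation: a linear $\mathfrak D:A\to A$ with $\mathfrak D(ab)=a\mathfrak D(b)+\mathfrak D(a)b+\lambda ab$. (Left) BiHom-pre-Lie algebra $(A,\circ,\alpha,\beta)$: bilinear $\circ$, commuting linear $\alpha,\beta$ multiplicative for $\circ$, with $\alpha\beta(a)\circ(\alpha(b)\circ c)-(\beta(a)\circ\alpha(b))\circ\beta(c)=\alpha\beta(b)\circ(\alpha(a)\circ c)-(\beta(b)\circ\alpha(a))\circ\beta(c)$. It is a BiHom-Novikov algebra if moreover $(a\circ\beta(b))\circ\alpha\beta(c)=(a\circ\beta(c))\circ\alpha\beta(b)$.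 BiHom-Novikov-Poisson algebra $(A,\cdot,\ast,\alpha,\beta)$: (1) $(A,\cdot,\alpha,\beta)$ is a BiHom-commutative BiHom-associative algebra; (2) $(A,\ast,\alpha,\beta)$ is a BiHom-Novikov algebra; (3) for all $a,b,c\in A$: $(\beta(a)\ast\alpha(b))\cdot\beta(c)-\alpha\beta(a)\ast(\alpha(b)\cdot c)=(\beta(b)\ast\alpha(a))\cdot\beta(c)-\alpha\beta(b)\ast(\alpha(a)\cdot c)$, $(a\cdot\beta(b))\ast\alpha\beta(c)=(a\ast\beta(c))\cdot\alpha\beta(b)$, $\alpha(a)\cdot(b\ast c)=(a\cdot b)\ast\beta(c)$. *)

theory Defs
  imports Main "HOL.Vector_Spaces"
begin

text \<open>The underlying vector space is the whole type \<^typ>\<open>'a\<close> with scalar multiplication \<open>scale\<close>;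
  a linear map on the tensor square is given as the corresponding bilinear map.\<close>

definition bilinear_op :: "('k::field \<Rightarrow> 'a::ab_group_add \<Rightarrow> 'a) \<Rightarrow> ('a \<Rightarrow> 'a \<Rightarrow> 'a) \<Rightarrow> bool"
  where "bilinear_op scale mul \<longleftrightarrow>
    (\<forall>a. Vector_Spaces.linear scale scale (\<lambda>b. mul a b)) \<and>
    (\<forall>b. Vector_Spaces.linear scale scale (\<lambda>a. mul a b))"

locale bihom_algebra = vector_space scale
  for scale :: "'k::field \<Rightarrow> 'a::ab_group_add \<Rightarrow> 'a" +
  fixes mul :: "'a \<Rightarrow> 'a \<Rightarrow> 'a"
    and \<alpha> \<beta> :: "'a \<Rightarrow> 'a"
  assumes bilinear_mul: "bilinear_op scale mul"
    and linear_alpha: "Vector_Spaces.linear scale scale \<alpha>"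
    and linear_beta: "Vector_Spaces.linear scale scale \<beta>"
    and alpha_beta_commute: "\<alpha> \<circ> \<beta> = \<beta> \<circ> \<alpha>"
    and alpha_mult: "\<alpha> (mul a b) = mul (\<alpha> a) (\<alpha> b)"
    and beta_mult: "\<beta> (mul a b) = mul (\<beta> a) (\<beta> b)"

locale bihom_associative_algebra = bihom_algebra +
  assumes bihom_assoc: "mul (\<alpha> a) (mul b c) = mul (mul a b) (\<beta> c)"

locale bihom_commutative_associative_algebra = bihom_associative_algebra +
  assumes bihom_comm: "mul (\<beta> a) (\<alpha> b) = mul (\<beta> b) (\<alpha> a)"

definition lambda_id_id_derivation ::
    "('k::field \<Rightarrow> 'a::ab_group_add \<Rightarrow> 'a) \<Rightarrow> ('a \<Rightarrow> 'a \<Rightarrow> 'a) \<Rightarrow> 'k \<Rightarrow> ('a \<Rightarrow> 'a) \<Rightarrow> bool"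
  where "lambda_id_id_derivation scale mul l D \<longleftrightarrow>
    Vector_Spaces.linear scale scale D \<and>
    (\<forall>a b. D (mul a b) = mul a (D b) + mul (D a) b + scale l (mul a b))"

locale bihom_pre_lie_algebra = bihom_algebra +
  assumes bihom_pre_lie:
    "mul (\<alpha> (\<beta> a)) (mul (\<alpha> b) c) - mul (mul (\<beta> a) (\<alpha> b)) (\<beta> c) =
     mul (\<alpha> (\<beta> b)) (mul (\<alpha> a) c) - mul (mul (\<beta> b) (\<alpha> a)) (\<beta> c)"

locale bihom_novikov_algebra = bihom_pre_lie_algebra +
  assumes bihom_novikov:
    "mul (mul a (\<beta> b)) (\<alpha> (\<beta> c)) = mul (mul a (\<beta> c)) (\<alpha> (\<beta> b))"

locale bihom_novikov_poisson_algebra =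
  dot: bihom_commutative_associative_algebra scale dot \<alpha> \<beta> +
  ast: bihom_novikov_algebra scale ast \<alpha> \<beta>
  for scale :: "'k::field \<Rightarrow> 'a::ab_group_add \<Rightarrow> 'a"
    and dot ast :: "'a \<Rightarrow> 'a \<Rightarrow> 'a"
    and \<alpha> \<beta> :: "'a \<Rightarrow> 'a" +
  assumes compat_left_symmetric:
    "dot (ast (\<beta> a) (\<alpha> b)) (\<beta> c) - ast (\<alpha> (\<beta> a)) (dot (\<alpha> b) c) =
     dot (ast (\<beta> b) (\<alpha> a)) (\<beta> c) - ast (\<alpha> (\<beta> b)) (dot (\<alpha> a) c)"
    and compat_right_commutative:
    "ast (dot a (\<beta> b)) (\<alpha> (\<beta> c)) = dot (ast a (\<beta> c)) (\<alpha> (\<beta> b))"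
    and compat_associative:
    "dot (\<alpha> a) (ast b c) = ast (dot a b) (\<beta> c)"

end

theory Submission
  imports Defs
begin

text \<open>Put \<open>E = D + \<kappa> id\<close>. Then \<open>a \<ast> b = a E(b)\<close>, and \<open>E\<close> is again a derivation of the
  same kind, of weight \<open>\<lambda> - \<kappa>\<close>, commuting with \<open>\<alpha>\<close> and \<open>\<beta>\<close>; so it suffices to treat \<open>\<kappa> = 0\<close>.
  There every axiom reduces, via BiHom-associativity, to BiHom-commutativity in the form
  \<open>\<alpha>\<beta>(a)(\<alpha>(b)c) = \<alpha>\<beta>(b)(\<alpha>(a)c)\<close> or \<open>(a\<beta>(b))\<alpha>\<beta>(c) = (a\<beta>(c))\<alpha>\<beta>(b)\<close>.\<close>

text \<open>On a product, the summand \<open>scale k\<close> contributes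
  \<open>scale k (mul a b)\<close> once on the left of the derivation rule but twice on the right,
  so the weight drops by \<open>k\<close>.\<close>

lemma lambda_id_id_derivation_add_scale:
  assumes "bihom_algebra scale mul \<alpha> \<beta>"
    and "lambda_id_id_derivation scale mul l D"
  shows "lambda_id_id_derivation scale mul (l - k) (\<lambda>x. D x + scale k x)"
proof -
  interpret bihom_algebra scale mul \<alpha> \<beta> by fact
  interpret vector_space_pair scale scale ..
  have D: "Vector_Spaces.linear scale scale D"
    and D_mul: "D (mul a b) = mul a (D b) + mul (D a) b + scale l (mul a b)" for a b
    using assms(2) by (auto simp: lambda_id_id_derivation_def)
  have right: "Vector_Spaces.linear scale scale (mul a)"
    and left: "Vector_Spaces.linear scale scale (\<lambda>x. mul x a)" for a
    using bilinear_mul by (auto simp: bilinear_op_def)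
  have "Vector_Spaces.linear scale scale (\<lambda>x. D x + scale k x)"
    by (intro linear_compose_add linear_compose_scale_right D linear_ident)
  moreover have "D (mul a b) + scale k (mul a b)
      = mul a (D b + scale k b) + mul (D a + scale k a) b + scale (l - k) (mul a b)" for a b
    by (simp add: D_mul linear_add[OF right] linear_add[OF left] linear_scale[OF right]
        linear_scale[OF left] scale_left_diff_distrib algebra_simps)
  ultimately show ?thesis
    by (simp add: lambda_id_id_derivation_def)
qed

context bihom_commutative_associative_algebra
begin

lemma linear_mul_right: "Vector_Spaces.linear scale scale (mul a)"
  and linear_mul_left: "Vector_Spaces.linear scale scale (\<lambda>x. mul x a)"
  using bilinear_mul by (auto simp: bilinear_op_def)

lemma alpha_beta_swap: "\<alpha> (\<beta> a) = \<beta> (\<alpha> a)"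
  using alpha_beta_commute by (simp add: fun_eq_iff)

text \<open>Associativity turns the left side into
  \<open>mul (mul (\<beta> a) (\<alpha> b)) (\<beta> c)\<close>, whose inner product is symmetric in
  \<open>a\<close> and \<open>b\<close> by \<open>bihom_comm\<close>.\<close>

lemma mul_left_symmetric: "mul (\<alpha> (\<beta> a)) (mul (\<alpha> b) c) = mul (\<alpha> (\<beta> b)) (mul (\<alpha> a) c)"
  by (simp only: bihom_assoc bihom_comm[of a])

text \<open>Reading \<open>\<alpha> (\<beta> c)\<close> as \<open>\<beta> (\<alpha> c)\<close>,
  associativity gives \<open>mul (\<alpha> a) (mul (\<beta> b) (\<alpha> c))\<close>, where
  \<open>bihom_comm\<close> exchanges \<open>b\<close> and \<open>c\<close>.\<close>

lemma mul_right_commutative: "mul (mul a (\<beta> b)) (\<alpha> (\<beta> c)) = mul (mul a (\<beta> c)) (\<alpha> (\<beta> b))"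
  by (simp only: alpha_beta_swap flip: bihom_assoc) (simp only: bihom_comm[of b])

lemma novikov_poisson_of_derivation:
  assumes der: "lambda_id_id_derivation scale mul l E"
    and alpha_E: "\<And>x. \<alpha> (E x) = E (\<alpha> x)"
    and beta_E: "\<And>x. \<beta> (E x) = E (\<beta> x)"
  shows "bihom_novikov_poisson_algebra scale mul (\<lambda>a b. mul a (E b)) \<alpha> \<beta>"
proof -
  interpret vector_space_pair scale scale ..
  have E: "Vector_Spaces.linear scale scale E"
    and E_mul: "E (mul a b) = mul a (E b) + mul (E a) b + scale l (mul a b)" for a b
    using der by (auto simp: lambda_id_id_derivation_def)
  \<comment> \<open>Of the three terms from the derivation rule, the one containing
    \<open>E (\<alpha> b)\<close> cancels against the subtracted product by associativity.\<close>
  have E_expand: "mul (\<alpha> (\<beta> a)) (E (mul (\<alpha> b) c)) - mul (mul (\<beta> a) (E (\<alpha> b))) (\<beta> c)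
      = mul (\<alpha> (\<beta> a)) (mul (\<alpha> b) (E c)) + scale l (mul (\<alpha> (\<beta> a)) (mul (\<alpha> b) c))" for a b c
    by (simp add: E_mul linear_add[OF linear_mul_right] linear_scale[OF linear_mul_right]
        flip: bihom_assoc)
  \<comment> \<open>Both surviving terms have the form treated by \<open>mul_left_symmetric\<close>,
    with last factor \<open>E c\<close> or \<open>c\<close>. Keeping \<open>c\<close> arbitrary lets
    this identity serve two axioms.\<close>
  have left_symmetric: "mul (\<alpha> (\<beta> a)) (E (mul (\<alpha> b) c)) - mul (mul (\<beta> a) (E (\<alpha> b))) (\<beta> c)
      = mul (\<alpha> (\<beta> b)) (E (mul (\<alpha> a) c)) - mul (mul (\<beta> b) (E (\<alpha> a))) (\<beta> c)" for a b c
    by (simp only: E_expand mul_left_symmetric[of a])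
  have right_commutative:
    "mul (mul a (E (\<beta> b))) (\<alpha> (\<beta> c)) = mul (mul a (\<beta> c)) (E (\<alpha> (\<beta> b)))" for a b c
    using mul_right_commutative[of a "E b" c] by (simp add: alpha_E beta_E)
  show ?thesis
  proof unfold_locales
    show "bilinear_op scale (\<lambda>a b. mul a (E b))"
      using linear_mul_left Vector_Spaces.linear_compose[OF E linear_mul_right]
      by (simp add: bilinear_op_def comp_def)
  next
    fix a b c
    show "\<alpha> (mul a (E b)) = mul (\<alpha> a) (E (\<alpha> b))"
      by (simp add: alpha_mult alpha_E)
    show "\<beta> (mul a (E b)) = mul (\<beta> a) (E (\<beta> b))"
      by (simp add: beta_mult beta_E)
    show "mul (\<alpha> (\<beta> a)) (E (mul (\<alpha> b) (E c))) - mul (mul (\<beta> a) (E (\<alpha> b))) (E (\<beta> c))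
      = mul (\<alpha> (\<beta> b)) (E (mul (\<alpha> a) (E c))) - mul (mul (\<beta> b) (E (\<alpha> a))) (E (\<beta> c))"
      \<comment> \<open>The pre-Lie identity is the instance \<open>E c\<close>, because
        \<open>\<beta> (E c) = E (\<beta> c)\<close>; the Novikov identity arises likewise from
        \<open>right_commutative\<close>.\<close>
      using left_symmetric[of a b "E c"] by (simp only: beta_E)
    show "mul (mul a (E (\<beta> b))) (E (\<alpha> (\<beta> c))) = mul (mul a (E (\<beta> c))) (E (\<alpha> (\<beta> b)))"
      using right_commutative[of a b "E c"] by (simp only: alpha_E beta_E)
    show "mul (mul (\<beta> a) (E (\<alpha> b))) (\<beta> c) - mul (\<alpha> (\<beta> a)) (E (mul (\<alpha> b) c))
      = mul (mul (\<beta> b) (E (\<alpha> a))) (\<beta> c) - mul (\<alpha> (\<beta> b)) (E (mul (\<alpha> a) c))"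
      \<comment> \<open>Here the same identity is used at \<open>c\<close> itself, with both sides
        negated.\<close>
      using left_symmetric[of a b c] by (metis minus_diff_eq)
    show "mul (mul a (\<beta> b)) (E (\<alpha> (\<beta> c))) = mul (mul a (E (\<beta> c))) (\<alpha> (\<beta> b))"
      by (rule right_commutative[symmetric])
    show "mul (\<alpha> a) (mul b (E c)) = mul (mul a b) (E (\<beta> c))"
      by (simp only: bihom_assoc beta_E)
  qed (simp_all add: alpha_beta_commute linear_add[OF linear_alpha] linear_scale[OF linear_alpha]
      linear_add[OF linear_beta] linear_scale[OF linear_beta])
qed

end

theorem proposition3p14:
  fixes scale :: "'k::field \<Rightarrow> 'a::ab_group_add \<Rightarrow> 'a"
    and mul :: "'a \<Rightarrow> 'a \<Rightarrow> 'a"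
    and \<alpha> \<beta> D :: "'a \<Rightarrow> 'a"
    and \<kappa> lam :: 'k
  assumes "bihom_commutative_associative_algebra scale mul \<alpha> \<beta>"
    and "lambda_id_id_derivation scale mul lam D"
    and "\<alpha> \<circ> \<beta> = \<beta> \<circ> \<alpha>"
    and "\<alpha> \<circ> D = D \<circ> \<alpha>"
    and "\<beta> \<circ> D = D \<circ> \<beta>"
  shows "bihom_novikov_poisson_algebra scale mul
           (\<lambda>a b. mul a (D b) + scale \<kappa> (mul a b)) \<alpha> \<beta>"
proof -
  interpret bihom_commutative_associative_algebra scale mul \<alpha> \<beta> by fact
  interpret vector_space_pair scale scale ..
  have "bihom_novikov_poisson_algebra scale mul (\<lambda>a b. mul a (D b + scale \<kappa> b)) \<alpha> \<beta>"
  proof (rule novikov_poisson_of_derivation)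
    show "lambda_id_id_derivation scale mul (lam - \<kappa>) (\<lambda>x. D x + scale \<kappa> x)"
      using bihom_algebra_axioms assms(2) by (rule lambda_id_id_derivation_add_scale)
    show "\<alpha> (D x + scale \<kappa> x) = D (\<alpha> x) + scale \<kappa> (\<alpha> x)" for x
      using assms(4) by (simp add: linear_add[OF linear_alpha] linear_scale[OF linear_alpha] fun_eq_iff)
    show "\<beta> (D x + scale \<kappa> x) = D (\<beta> x) + scale \<kappa> (\<beta> x)" for x
      using assms(5) by (simp add: linear_add[OF linear_beta] linear_scale[OF linear_beta] fun_eq_iff)
  qed
  then show ?thesis
    by (simp add: linear_add[OF linear_mul_right] linear_scale[OF linear_mul_right])
qed

end
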